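(* Let $X$ be a (real) normed space, $C\subseteq X$ closed and convex, and $S:C\to C$ a nonexpansive mapping with nonempty fixed point set. Let $u,x_0\in C$ and let $M>0$ be such that $2\max\{\Vert p-x_0\Vert,\Vert p-u\Vert\}\le M$ for some fixed point $p$ of $S$. Let $(\alpha_n)_{n\ge0}\subset(0,1)$ and let $R_1,R_2,R_3:(0,\infty)\to\mathbb N$ satisfy (i) for all $\varepsilon>0$ and all $n\ge R_1(\varepsilon)$: $\alpha_n\le\varepsilon$; (ii) for all $\varepsilon>0$: $\prod_{k=1}^{R_2(\varepsilon)}(1-\alpha_k)\le\varepsilon$; (iii) for all $\varepsilon>0$ and all $n\ge R_3(\varepsilon)$ with $n\ge1$: $|\alpha_n-\alpha_{n-1}|\le\varepsilon\alpha_n$. Suppose moreover that $D:(0,\infty)\to(0,\infty)$ satisfies, for all $\varepsilon>0$, $$0<D(\varepsilon)\le\prod_{k=0}^{R_3(\varepsilon/(3M))}(1-\alpha_k).$$ Then the sequence $(x_n)$ generated from $x_0$ by $x_{n+1}:=\alpha_nu+(1-\alpha_n)Sx_n$ is asymptotically regular with rate $$\psi(\varepsilon):=\max\left\{R_1\left(\frac{\varepsilon}{2M}\right),\ R_2\left(\frac{\varepsilon\, D(\varepsilon/2)}{6M}\right),\ R_3\left(\frac{\varepsilon}{6M}\right)\right\},$$ that is, for all $\varepsilon>0$ and all $n\ge\psi(\varepsilon)$, $\Vert x_n-Sx_n\Vert\le\varepsilon$.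
   Context: A map $S:C\to C$ is nonexpansive if $\Vert Sx-Sy\Vert\le\Vert x-y\Vert$ for all $x,y\in C$. A rate of asymptotic regularity for $(x_n)$ is a rate of convergence for $\Vert x_n-Sx_n\Vert\to0$. $\mathbb N$ contains $0$, and empty products equal $1$. *)

theory Defs
  imports "HOL-Analysis.Analysis"
begin

definition nonexpansive_on :: "'a::real_normed_vector set \<Rightarrow> ('a \<Rightarrow> 'a) \<Rightarrow> bool" where
  "nonexpansive_on C S \<longleftrightarrow> (\<forall>x\<in>C. \<forall>y\<in>C. norm (S x - S y) \<le> norm (x - y))"

definition fixed_points :: "'a set \<Rightarrow> ('a \<Rightarrow> 'a) \<Rightarrow> 'a set" where
  "fixed_points C S = {p \<in> C. S p = p}"

text \<open>Functions on $(0,\infty)$ are total functions on \<^typ>\<open>real\<close>, only ever constrained and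
  evaluated at positive arguments.\<close>

definition rate_of_convergence :: "(nat \<Rightarrow> 'a::metric_space) \<Rightarrow> 'a \<Rightarrow> (real \<Rightarrow> nat) \<Rightarrow> bool" where
  "rate_of_convergence a l r \<longleftrightarrow> (\<forall>\<epsilon>>0. \<forall>n\<ge>r \<epsilon>. dist (a n) l \<le> \<epsilon>)"

definition rate_of_asymptotic_regularity ::
    "('a::real_normed_vector \<Rightarrow> 'a) \<Rightarrow> (nat \<Rightarrow> 'a) \<Rightarrow> (real \<Rightarrow> nat) \<Rightarrow> bool" where
  "rate_of_asymptotic_regularity S x r \<longleftrightarrow> rate_of_convergence (\<lambda>n. norm (x n - S (x n))) 0 r"

end

theory Submission imports Defs begin

text \<open>
  The increments \<open>d n = norm (x (Suc n) - x n)\<close> satisfy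
  \<open>d n \<le> (1 - \<alpha> n) * d (n - 1) + M * \<bar>\<alpha> n - \<alpha> (n - 1)\<bar>\<close>, and by the third condition the last term
  is at most \<open>\<alpha> n * c\<close> for a small \<open>c\<close> from some index \<open>N\<close> on. Iterating from \<open>N\<close>, \<open>d n\<close> is
  at most \<open>c\<close> plus \<open>M\<close> times the product of \<open>1 - \<alpha> k\<close> over \<open>N < k \<le> n\<close>; that product
  is small because the full product is, while \<open>D\<close> bounds the removed initial part from below.
  Finally \<open>norm (x n - S (x n)) \<le> d n + M * \<alpha> n\<close>.
\<close>

text \<open>Each step is an affine map with fixed point \<open>c\<close> and slope
  \<open>1 - a (Suc n)\<close>, so the excess of \<open>d\<close> over \<open>c\<close> shrinks by
  that factor. Nonnegativity of the slopes lets the bound pass through the induction;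
  \<open>c \<ge> 0\<close> settles the start, where the product is empty.\<close>

lemma affine_recursion_bound:
  fixes d a :: "nat \<Rightarrow> real"
  assumes "c \<ge> 0"
    and "\<And>n. a n \<le> 1"
    and step: "\<And>n. n \<ge> N \<Longrightarrow> d (Suc n) \<le> (1 - a (Suc n)) * d n + a (Suc n) * c"
    and "n \<ge> N"
  shows "d n \<le> c + (\<Prod>k=Suc N..n. 1 - a k) * d N"
  using \<open>n \<ge> N\<close>
proof (induction n rule: dec_induct)
  case base
  then show ?case using \<open>c \<ge> 0\<close> by simp
next
  case (step n)
  have "d (Suc n) \<le> (1 - a (Suc n)) * d n + a (Suc n) * c"
    using assms(3) step.hyps by simp
  also have "\<dots> \<le> (1 - a (Suc n)) * (c + (\<Prod>k=Suc N..n. 1 - a k) * d N) + a (Suc n) * c"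
    using step.IH assms(2)[of "Suc n"] by (intro add_right_mono mult_left_mono) auto
  also have "\<dots> = c + (\<Prod>k=Suc N..Suc n. 1 - a k) * d N"
    using step.hyps by (simp add: algebra_simps)
  finally show ?case .
qed

lemma halpern_in_convex:
  fixes S :: "'a::real_normed_vector \<Rightarrow> 'a"
  assumes "convex C" and "S \<in> C \<rightarrow> C" and "u \<in> C" and "x 0 \<in> C"
    and "\<And>n. \<alpha> n \<in> {0..1}"
    and "\<And>n. x (Suc n) = \<alpha> n *\<^sub>R u + (1 - \<alpha> n) *\<^sub>R S (x n)"
  shows "x n \<in> C"
proof (induction n)
  case (Suc n)
  then have "S (x n) \<in> C" using assms(2) by auto
  then show ?case
    using assms(5)[of n] convexD[OF \<open>convex C\<close> \<open>u \<in> C\<close>] by (simp add: assms(6))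
qed (use assms(4) in simp)

text \<open>The ball of radius \<open>B\<close> around \<open>p\<close> is mapped into itself by
  \<open>S\<close>, as far as the iterates are concerned, and each new iterate is a convex
  combination of two of its points, \<open>u\<close> and \<open>S (x n)\<close>.\<close>

lemma halpern_dist_fixed_point_le:
  fixes S :: "'a::real_normed_vector \<Rightarrow> 'a"
  assumes "nonexpansive_on C S" and "p \<in> fixed_points C S" and "\<And>n. x n \<in> C"
    and "norm (u - p) \<le> B" and "norm (x 0 - p) \<le> B"
    and "\<And>n. \<alpha> n \<in> {0..1}"
    and "\<And>n. x (Suc n) = \<alpha> n *\<^sub>R u + (1 - \<alpha> n) *\<^sub>R S (x n)"
  shows "norm (x n - p) \<le> B" and "norm (S (x n) - p) \<le> B"
proof -
  have S_le: "norm (S (x n) - p) \<le> norm (x n - p)" for n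
    using assms(1-3) unfolding nonexpansive_on_def fixed_points_def by fastforce
  show x_le: "norm (x n - p) \<le> B" for n
  proof (induction n)
    case (Suc n)
    have "x (Suc n) - p = \<alpha> n *\<^sub>R (u - p) + (1 - \<alpha> n) *\<^sub>R (S (x n) - p)"
      by (simp add: assms(7) algebra_simps)
    then have "norm (x (Suc n) - p) \<le> \<alpha> n * norm (u - p) + (1 - \<alpha> n) * norm (S (x n) - p)"
      using norm_triangle_ineq[of "\<alpha> n *\<^sub>R (u - p)" "(1 - \<alpha> n) *\<^sub>R (S (x n) - p)"]
        assms(6)[of n] by simp
    also have "\<dots> \<le> B"
      using assms(4) S_le[of n] Suc.IH assms(6)[of n] by (intro convex_bound_le) auto
    finally show ?case .
  qed (use assms(5) in simp)
  show "norm (S (x n) - p) \<le> B"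
    using S_le[of n] x_le[of n] by simp
qed

text \<open>In the difference of two consecutive recursion steps, the change of \<open>S\<close> is
  weighted by the newer coefficient, which leaves the change of coefficient on the older vector
  \<open>u - S (x n)\<close>.\<close>

lemma halpern_increment_le:
  fixes S :: "'a::real_normed_vector \<Rightarrow> 'a"
  assumes "nonexpansive_on C S" and "\<And>n. x n \<in> C" and "\<And>n. \<alpha> n \<in> {0..1}"
    and "\<And>n. norm (u - S (x n)) \<le> M"
    and "\<And>n. x (Suc n) = \<alpha> n *\<^sub>R u + (1 - \<alpha> n) *\<^sub>R S (x n)"
  shows "norm (x (Suc (Suc n)) - x (Suc n))
    \<le> (1 - \<alpha> (Suc n)) * norm (x (Suc n) - x n) + \<bar>\<alpha> (Suc n) - \<alpha> n\<bar> * M"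
proof -
  have "x (Suc (Suc n)) - x (Suc n) = (1 - \<alpha> (Suc n)) *\<^sub>R (S (x (Suc n)) - S (x n))
      + (\<alpha> (Suc n) - \<alpha> n) *\<^sub>R (u - S (x n))"
    unfolding assms(5)[of "Suc n"] assms(5)[of n] by (simp add: algebra_simps)
  then have "norm (x (Suc (Suc n)) - x (Suc n))
      \<le> norm ((1 - \<alpha> (Suc n)) *\<^sub>R (S (x (Suc n)) - S (x n)))
        + norm ((\<alpha> (Suc n) - \<alpha> n) *\<^sub>R (u - S (x n)))"
    by (simp only: norm_triangle_ineq)
  also have "\<dots> = (1 - \<alpha> (Suc n)) * norm (S (x (Suc n)) - S (x n))
      + \<bar>\<alpha> (Suc n) - \<alpha> n\<bar> * norm (u - S (x n))"
    using assms(3)[of "Suc n"] by simp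
  also have "\<dots> \<le> (1 - \<alpha> (Suc n)) * norm (x (Suc n) - x n) + \<bar>\<alpha> (Suc n) - \<alpha> n\<bar> * M"
    using assms(1-4) assms(3)[of "Suc n"] unfolding nonexpansive_on_def
    by (intro add_mono mult_left_mono) auto
  finally show ?thesis .
qed

theorem proposition3p1:
  fixes C :: "'a::real_normed_vector set"
    and S :: "'a \<Rightarrow> 'a"
    and u x0 :: 'a
    and x :: "nat \<Rightarrow> 'a"
    and M :: real
    and \<alpha> :: "nat \<Rightarrow> real"
    and R1 R2 R3 :: "real \<Rightarrow> nat"
    and D :: "real \<Rightarrow> real"
  assumes "closed C" and "convex C"
    and "S \<in> C \<rightarrow> C" and "nonexpansive_on C S"
    and "fixed_points C S \<noteq> {}"
    and "u \<in> C" and "x0 \<in> C"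
    and "M > 0"
    and "\<exists>p\<in>fixed_points C S. 2 * max (norm (p - x0)) (norm (p - u)) \<le> M"
    and "\<And>n. \<alpha> n \<in> {0<..<1}"
    and R1: "\<And>\<epsilon> n. \<epsilon> > 0 \<Longrightarrow> n \<ge> R1 \<epsilon> \<Longrightarrow> \<alpha> n \<le> \<epsilon>"
    and R2: "\<And>\<epsilon>. \<epsilon> > 0 \<Longrightarrow> (\<Prod>k=1..R2 \<epsilon>. 1 - \<alpha> k) \<le> \<epsilon>"
    and R3: "\<And>\<epsilon> n. \<epsilon> > 0 \<Longrightarrow> n \<ge> R3 \<epsilon> \<Longrightarrow> n \<ge> 1 \<Longrightarrow> \<bar>\<alpha> n - \<alpha> (n - 1)\<bar> \<le> \<epsilon> * \<alpha> n"
    and D: "\<And>\<epsilon>. \<epsilon> > 0 \<Longrightarrow> 0 < D \<epsilon> \<and> D \<epsilon> \<le> (\<Prod>k=0..R3 (\<epsilon> / (3 * M)). 1 - \<alpha> k)"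
    and "x 0 = x0"
    and "\<And>n. x (Suc n) = \<alpha> n *\<^sub>R u + (1 - \<alpha> n) *\<^sub>R S (x n)"
  shows "rate_of_asymptotic_regularity S x
    (\<lambda>\<epsilon>. Max {R1 (\<epsilon> / (2 * M)), R2 (\<epsilon> * D (\<epsilon> / 2) / (6 * M)), R3 (\<epsilon> / (6 * M))})"
proof -
  obtain p where p: "p \<in> fixed_points C S"
    and pM: "2 * max (norm (p - x0)) (norm (p - u)) \<le> M"
    using assms(9) by blast
  have \<alpha>01: "\<alpha> n \<in> {0..1}" for n
    using assms(10)[of n] by simp
  have xC: "x n \<in> C" for n
    using halpern_in_convex[where x = x and \<alpha> = \<alpha>, OF assms(2,3,6) _ \<alpha>01 assms(16)] assms(7,15) by simp
  \<comment> \<open>The radius is \<open>M / 2\<close>, so that any two points within it of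
    \<open>p\<close> are at most \<open>M\<close> apart.\<close>
  have "norm (x0 - p) \<le> M / 2" and up: "norm (u - p) \<le> M / 2"
    using pM by (simp_all add: norm_minus_commute max_def split: if_splits)
  then have xp: "norm (x n - p) \<le> M / 2" and Sp: "norm (S (x n) - p) \<le> M / 2" for n
    using halpern_dist_fixed_point_le[where x = x and \<alpha> = \<alpha>, OF assms(4) p xC up _ \<alpha>01 assms(16)]
      assms(15)
    by simp_all
  have uS: "norm (u - S (x n)) \<le> M" for n
    using norm_triangle_ineq4[of "u - p" "S (x n) - p"] up Sp[of n] by simp
  define d where "d n = norm (x (Suc n) - x n)" for n
  have dM: "d n \<le> M" for n
    using norm_triangle_ineq4[of "x (Suc n) - p" "x n - p"] xp[of n] xp[of "Suc n"]
    by (simp add: d_def)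
  have increments: "d n \<le> \<delta>"
    if "\<delta> > 0" and n2: "n \<ge> R2 (\<delta> * D \<delta> / (3 * M))" and n3: "n \<ge> R3 (\<delta> / (3 * M))" for \<delta> n
  proof -
    define N where "N = R3 (\<delta> / (3 * M))"
    define P where "P A = (\<Prod>k\<in>A. 1 - \<alpha> k)" for A :: "nat set"
    have \<alpha>1: "0 < 1 - \<alpha> k" "1 - \<alpha> k \<le> 1" for k
      using assms(10)[of k] by simp_all
    have P_pos: "P A > 0" for A
      unfolding P_def using \<alpha>1 by (intro prod_pos) simp
    have P_antimono: "P B \<le> P A" if "finite B" "A \<subseteq> B" for A B
    proof -
      have "P B = P (B - A) * P A"
        unfolding P_def using that by (intro prod.subset_diff)
      moreover have "P (B - A) \<le> 1"
        unfolding P_def using \<alpha>1 by (intro prod_le_1) (auto intro: less_imp_le)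
      ultimately show ?thesis
        using mult_right_mono[of "P (B - A)" 1 "P A"] P_pos[of A] by simp
    qed
    have step: "d (Suc k) \<le> (1 - \<alpha> (Suc k)) * d k + \<alpha> (Suc k) * (\<delta> / 3)" if "k \<ge> N" for k
    proof -
      have "\<bar>\<alpha> (Suc k) - \<alpha> k\<bar> \<le> \<delta> / (3 * M) * \<alpha> (Suc k)"
        using R3[of "\<delta> / (3 * M)" "Suc k"] \<open>\<delta> > 0\<close> \<open>M > 0\<close> that by (simp add: N_def)
      then have "\<bar>\<alpha> (Suc k) - \<alpha> k\<bar> * M \<le> \<alpha> (Suc k) * (\<delta> / 3)"
        using \<open>M > 0\<close> by (simp add: field_simps)
      then show ?thesis
        using halpern_increment_le[where x = x and \<alpha> = \<alpha>, OF assms(4) xC \<alpha>01 uS assms(16), of k]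
        by (simp add: d_def)
    qed
    have D_pos: "D \<delta> > 0" and "D \<delta> \<le> P {0..N}"
      using D[OF \<open>\<delta> > 0\<close>] by (simp_all add: P_def N_def)
    \<comment> \<open>\<open>D\<close> is tied to a product from index 0, \<open>R2\<close> to one
      from index 1; dropping the factor \<open>1 - \<alpha> 0 < 1\<close> only enlarges the
      product.\<close>
    then have "D \<delta> \<le> P {1..N}"
      using P_antimono[of "{0..N}" "{1..N}"] by fastforce
    \<comment> \<open>The tail is compared with the full product without dividing: the factor
      \<open>D \<delta>\<close> built into the argument of \<open>R2\<close> cancels at the end of
      the chain.\<close>
    then have "D \<delta> * P {Suc N..n} \<le> P {1..N} * P {Suc N..n}"
      using P_pos by (intro mult_right_mono) (auto intro: less_imp_le)
    also have "\<dots> = P {1..n}"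
      using n3 unfolding P_def N_def
      by (subst prod.union_disjoint[symmetric]) (auto intro: prod.cong)
    also have "\<dots> \<le> P {1..R2 (\<delta> * D \<delta> / (3 * M))}"
      using n2 by (intro P_antimono) auto
    also have "\<dots> \<le> \<delta> * D \<delta> / (3 * M)"
      using R2[of "\<delta> * D \<delta> / (3 * M)"] \<open>\<delta> > 0\<close> \<open>M > 0\<close> D_pos by (simp add: P_def)
    finally have "P {Suc N..n} * M \<le> \<delta> / 3"
      using D_pos \<open>M > 0\<close> by (simp add: field_simps)
    moreover have "P {Suc N..n} * d N \<le> P {Suc N..n} * M"
      using P_pos[of "{Suc N..n}"] dM by (intro mult_left_mono) auto
    moreover have "d n \<le> \<delta> / 3 + P {Suc N..n} * d N"
      using affine_recursion_bound[of "\<delta> / 3" \<alpha> N d n, OF _ _ step] \<open>\<delta> > 0\<close> \<alpha>01 n3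
      by (simp add: P_def N_def)
    ultimately show ?thesis
      using \<open>\<delta> > 0\<close> by simp
  qed
  have "norm (x n - S (x n)) \<le> \<epsilon>"
    if "\<epsilon> > 0" and n1: "n \<ge> R1 (\<epsilon> / (2 * M))" and n2: "n \<ge> R2 (\<epsilon> * D (\<epsilon> / 2) / (6 * M))"
      and n3: "n \<ge> R3 (\<epsilon> / (6 * M))" for \<epsilon> n
  proof -
    \<comment> \<open>With \<open>\<delta> = \<epsilon> / 2\<close> the denominators
      \<open>3 * M\<close> become the \<open>6 * M\<close> of the claimed rate.\<close>
    have "d n \<le> \<epsilon> / 2"
      using increments[of "\<epsilon> / 2" n] \<open>\<epsilon> > 0\<close> n2 n3 by simp
    moreover have "\<alpha> n * M \<le> \<epsilon> / 2"
      using R1[OF _ n1] \<open>\<epsilon> > 0\<close> \<open>M > 0\<close> by (simp add: field_simps)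
    moreover have "\<alpha> n * norm (u - S (x n)) \<le> \<alpha> n * M"
      using uS \<alpha>01[of n] by (intro mult_left_mono) auto
    \<comment> \<open>This inserts \<open>x (Suc n)\<close>, whose difference from
      \<open>S (x n)\<close> is \<open>\<alpha> n *\<^sub>R (u - S (x n))\<close> by the
      recursion.\<close>
    moreover have "x n - S (x n) = \<alpha> n *\<^sub>R (u - S (x n)) - (x (Suc n) - x n)"
      by (simp add: assms(16) algebra_simps)
    then have "norm (x n - S (x n)) \<le> norm (\<alpha> n *\<^sub>R (u - S (x n))) + d n"
      unfolding d_def by (simp only: norm_triangle_ineq4)
    then have "norm (x n - S (x n)) \<le> \<alpha> n * norm (u - S (x n)) + d n"
      using \<alpha>01[of n] by simp
    ultimately show ?thesis by simp
  qed
  then show ?thesis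
    by (simp add: rate_of_asymptotic_regularity_def rate_of_convergence_def)
qed

end
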